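(* There is an absolute constant $C>0$ such that for all $d,k,n\in\mathbb{N}$ with $2k\le n$, $$\delta(n,k,\mathrm{IP}(d))\le C\,\frac{d^2}{k}.$$
   Context: A pattern of order $t$ is an element $P\in\{+,-\}^t$. For $A,B\subset[n]$ write $\mathrm{pat}(A,B)=P$ if $A\triangle B=\{j_1,\dots,j_t\}$ with $j_1<\dots<j_t$, $P$ has order $t$, and $\{i\in[t]:P_i=+\}=\{i\in[t]: j_i\in A\setminus B\}$. A family $\mathcal{A}$ of subsets of $[n]$ is $P$-free if $\mathrm{pat}(A,B)\neq P$ for all $A,B\in\mathcal{A}$. $\delta(n,k,P)$ denotes the maximum size of a $P$-free family $\mathcal{A}\subset\binom{[n]}{k}$ divided by $\binom{n}{k}$. The interval pattern $\mathrm{IP}(d)\in\{+,-\}^{2d}$ consists of $d$ plus signs followed by $d$ minus signs. *)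

theory Defs
  imports Complex_Main
begin

datatype sign = Plus | Minus

text \<open>A pattern of order \<open>t\<close> is a list of signs of length \<open>t\<close>.\<close>

type_synonym pattern = "sign list"

text \<open>
  The function is only meaningful for sets with finite symmetric difference, since
  \<^const>\<open>sorted_list_of_set\<close> returns the empty list on infinite sets.
\<close>

definition pat :: "nat set \<Rightarrow> nat set \<Rightarrow> pattern" where
  "pat A B = map (\<lambda>j. if j \<in> A - B then Plus else Minus) (sorted_list_of_set (sym_diff A B))"

lemma pat_eq_iff:
  assumes "finite A" "finite B"
  shows "pat A B = P \<longleftrightarrow>
    (\<exists>js. sym_diff A B = set js \<and> sorted_wrt (<) js \<and> length P = length js \<and>
      {i. i < length P \<and> P ! i = Plus} = {i. i < length P \<and> js ! i \<in> A - B})"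
proof -
  have sorted: "set js = D \<and> sorted_wrt (<) js \<longleftrightarrow> js = sorted_list_of_set D"
    if "finite D" for js and D :: "nat set"
    using that sorted_list_of_set.sorted_key_list_of_set_unique[of D js]
    by (metis distinct_card strict_sorted_list_of_set strict_sorted_iff)
  have ex: "Q (sorted_list_of_set D) \<longleftrightarrow> (\<exists>js. D = set js \<and> sorted_wrt (<) js \<and> Q js)"
    if "finite D" for Q and D :: "nat set"
  proof
    assume Q: "Q (sorted_list_of_set D)"
    show "\<exists>js. D = set js \<and> sorted_wrt (<) js \<and> Q js"
      by (rule exI[of _ "sorted_list_of_set D"]) (simp add: Q that)
  next
    assume "\<exists>js. D = set js \<and> sorted_wrt (<) js \<and> Q js"
    then obtain js where "D = set js" "sorted_wrt (<) js" "Q js"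
      by blast
    with sorted[OF that, of js] show "Q (sorted_list_of_set D)"
      by metis
  qed
  have sign: "(if b then Plus else Minus) = s \<longleftrightarrow> (s = Plus \<longleftrightarrow> b)" for b s
    by (cases s) simp_all
  have map: "map (\<lambda>j. if j \<in> X then Plus else Minus) js = P \<longleftrightarrow>
      length P = length js \<and>
      {i. i < length P \<and> P ! i = Plus} = {i. i < length P \<and> js ! i \<in> X}"
    for js and X :: "nat set"
  proof -
    have "map (\<lambda>j. if j \<in> X then Plus else Minus) js = P \<longleftrightarrow>
        length P = length js \<and> (\<forall>i<length P. P ! i = Plus \<longleftrightarrow> js ! i \<in> X)"
      by (auto simp only: list_eq_iff_nth_eq length_map nth_map sign)
    then show ?thesis
      by blast
  qed
  have "finite (sym_diff A B)"
    using assms by blast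
  then show ?thesis
    unfolding pat_def map by (rule ex)
qed

definition pattern_free :: "pattern \<Rightarrow> nat set set \<Rightarrow> bool" where
  "pattern_free P \<A> \<longleftrightarrow> (\<forall>A\<in>\<A>. \<forall>B\<in>\<A>. pat A B \<noteq> P)"

definition delta :: "nat \<Rightarrow> nat \<Rightarrow> pattern \<Rightarrow> real" where
  "delta n k P =
     real (Max {card \<A> |\<A>. \<A> \<subseteq> {A. A \<subseteq> {1..n} \<and> card A = k} \<and> pattern_free P \<A>})
       / real (n choose k)"

text \<open>The maximum is over a finite nonempty set, so \<^const>\<open>Max\<close> is meaningful.\<close>

lemma delta_Max_welldefined:
  fixes n k :: nat and P :: pattern
  defines "S \<equiv> {card \<A> |\<A>. \<A> \<subseteq> {A. A \<subseteq> {1..n} \<and> card A = k} \<and> pattern_free P \<A>}"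
  shows "finite S" and "S \<noteq> {}"
proof -
  have "S \<subseteq> card ` Pow (Pow {1..n})"
    unfolding S_def by auto
  then show "finite S"
    by (rule finite_subset) simp
  have "card ({} :: nat set set) \<in> S"
    unfolding S_def pattern_free_def by blast
  then show "S \<noteq> {}"
    by blast
qed

definition IP :: "nat \<Rightarrow> pattern" where
  "IP d = replicate d Plus @ replicate d Minus"

end

theory Submission
  imports Defs
begin

text \<open>
  Let \<open>m\<close> be about \<open>k / (4 d\<^sup>2)\<close> and let \<open>J\<^sub>0 < \<dots> < J\<^bsub>m-1\<^esub>\<close> be consecutive blocks of \<open>s = n div m\<close>
  integers. If \<open>D \<subseteq> K \<inter> J\<^sub>i\<close> and \<open>E \<subseteq> K \<inter> J\<^sub>j\<close> are \<open>d\<close>-sets with \<open>i < j\<close>, then \<open>K - E\<close> and \<open>K - D\<close>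
  have pattern \<open>IP d\<close>. Hence, for a fixed \<open>(k + d)\<close>-set \<open>K\<close>, deleting \<open>d\<close>-subsets can lead into an
  \<open>IP d\<close>-free family \<open>\<F>\<close> from one block only, and the fractions of \<open>d\<close>-subsets of \<open>K \<inter> J\<^sub>i\<close> which do
  so sum to at most 1 over \<open>i\<close>. Summing over all \<open>K\<close> gives
  \<open>(\<Sum>A\<in>\<F>. \<Sum>i<m. (s - a\<^sub>i choose d) / (a\<^sub>i + d choose d)) \<le> (n choose (k + d))\<close> with \<open>a\<^sub>i = |A \<inter> J\<^sub>i|\<close>.
  The summand is essentially convex and decreasing in \<open>a\<^sub>i\<close>, and the \<open>a\<^sub>i\<close> have sum at most \<open>k\<close>, so
  for every \<open>A\<close> the inner sum is at least its value at equal \<open>a\<^sub>i\<close>, which is at least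
  \<open>m/3 * ((n - k)/k)\<^sup>d\<close>; and \<open>(n choose (k + d)) \<le> ((n - k)/k)\<^sup>d * (n choose k)\<close>.
\<close>

section \<open>Deletions from a common superset\<close>

text \<open>The two sets differ exactly in \<open>D \<union> E\<close>. Deleting \<open>E\<close>
  keeps \<open>D\<close>, so \<open>D\<close> carries the plus signs, and all of \<open>D\<close>
  precedes \<open>E\<close>.\<close>

lemma pat_Diff_eq_IP:
  assumes "finite K" "D \<subseteq> K" "E \<subseteq> K" "card D = d" "card E = d"
    and less: "\<And>x y. x \<in> D \<Longrightarrow> y \<in> E \<Longrightarrow> x < y"
  shows "pat (K - E) (K - D) = IP d"
proof -
  have fin: "finite D" "finite E"
    using assms finite_subset by blast+
  have disj: "D \<inter> E = {}"
    using less by blast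
  have AB: "(K - E) - (K - D) = D"
    using assms(2) disj by blast
  have BA: "(K - D) - (K - E) = E"
    using assms(3) disj by blast
  have "sorted_list_of_set (D \<union> E) = sorted_list_of_set D @ sorted_list_of_set E"
  proof (rule sorted_distinct_set_unique)
    show "sorted (sorted_list_of_set D @ sorted_list_of_set E)"
      using fin less by (auto simp: sorted_append intro: less_imp_le)
    show "distinct (sorted_list_of_set D @ sorted_list_of_set E)"
      using fin disj by simp
  qed (use fin in simp_all)
  moreover have "map (\<lambda>j. if j \<in> D then Plus else Minus) (sorted_list_of_set D) = replicate d Plus"
    using fin assms(4) by (intro replicate_eqI) auto
  moreover have "map (\<lambda>j. if j \<in> D then Plus else Minus) (sorted_list_of_set E) = replicate d Minus"
    using fin disj assms(5) by (intro replicate_eqI) auto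
  ultimately show ?thesis
    unfolding pat_def AB BA IP_def by (simp only: map_append)
qed

lemma weight_le_one:
  fixes J :: "nat \<Rightarrow> nat set"
  assumes free: "pattern_free (IP d) \<F>" and "finite K"
    and less: "\<And>i j x y. i < j \<Longrightarrow> x \<in> J i \<Longrightarrow> y \<in> J j \<Longrightarrow> x < y"
  shows "(\<Sum>i<m. real (card {D. D \<subseteq> K \<inter> J i \<and> card D = d \<and> K - D \<in> \<F>})
           / real (card (K \<inter> J i) choose d)) \<le> 1"
proof -
  define T where "T i = {D. D \<subseteq> K \<inter> J i \<and> card D = d \<and> K - D \<in> \<F>}" for i
  define f where "f i = real (card (T i)) / real (card (K \<inter> J i) choose d)" for i
  \<comment> \<open>If \<open>K \<inter> J i\<close> has fewer than \<open>d\<close> elements, the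
    denominator is 0 and so is \<open>f i\<close>.\<close>
  have f1: "f i \<le> 1" for i
  proof -
    have "card (T i) \<le> card {D. D \<subseteq> K \<inter> J i \<and> card D = d}"
      unfolding T_def using assms(2) by (intro card_mono) auto
    also have "\<dots> = card (K \<inter> J i) choose d"
      using assms(2) by (intro n_subsets) simp
    finally show ?thesis
      unfolding f_def by (simp add: divide_le_eq_1) linarith
  qed
  have cross: "False" if "i < j" "D \<in> T i" "E \<in> T j" for i j D E
  proof -
    have "pat (K - E) (K - D) = IP d"
    proof (rule pat_Diff_eq_IP)
      show "x < y" if "x \<in> D" "y \<in> E" for x y
        using that \<open>D \<in> T i\<close> \<open>E \<in> T j\<close> unfolding T_def
        by (intro less[OF \<open>i < j\<close>]) auto
    qed (use that assms(2) in \<open>auto simp: T_def\<close>)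
    then show False
      using free that unfolding pattern_free_def T_def by blast
  qed
  have "(\<Sum>i<m. f i) \<le> 1"
  proof (cases "\<exists>i<m. T i \<noteq> {}")
    case True
    then obtain i where i: "i < m" "T i \<noteq> {}"
      by blast
    have "T j = {}" if "j \<noteq> i" for j
      using i cross that by (meson ex_in_conv nat_neq_iff)
    then have "f j = 0" if "j \<noteq> i" for j
      unfolding f_def using that by simp
    then have "(\<Sum>j<m. f j) = (\<Sum>j\<in>{i}. f j)"
      using i by (intro sum.mono_neutral_right) auto
    then show ?thesis
      using f1 by simp
  next
    case False
    then show ?thesis
      by (simp add: f_def)
  qed
  then show ?thesis
    unfolding f_def T_def .
qed

section \<open>Double counting\<close>

text \<open>The pairs \<open>(K, D)\<close> and \<open>(A, D)\<close> correspond via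
  \<open>A = K - D\<close> and \<open>K = A \<union> D\<close>. The weight of a pair depends only on
  \<open>card (K \<inter> J) = card (A \<inter> J) + d\<close>, so it is constant for fixed
  \<open>A\<close>.\<close>

lemma sum_weight_swap:
  fixes J :: "nat set"
  assumes F: "\<F> \<subseteq> {A. A \<subseteq> {1..n} \<and> card A = k}" and J: "J \<subseteq> {1..n}"
  shows "(\<Sum>K | K \<subseteq> {1..n} \<and> card K = k + d.
            real (card {D. D \<subseteq> K \<inter> J \<and> card D = d \<and> K - D \<in> \<F>}) / real (card (K \<inter> J) choose d))
       = (\<Sum>A\<in>\<F>. real ((card J - card (A \<inter> J)) choose d) / real (card (A \<inter> J) + d choose d))"
    (is "?L = ?R")
proof -
  let ?KK = "{K. K \<subseteq> {1..n} \<and> card K = k + d}"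
  let ?T = "\<lambda>K. {D. D \<subseteq> K \<inter> J \<and> card D = d \<and> K - D \<in> \<F>}"
  let ?S = "\<lambda>A. {D. D \<subseteq> J - A \<and> card D = d}"
  have finJ: "finite J"
    using J finite_subset by blast
  have finA: "finite A" "card A = k" "A \<subseteq> {1..n}" if "A \<in> \<F>" for A
    using that F finite_subset[of A "{1..n}"] by auto
  have finF: "finite \<F>"
    using F by (rule finite_subset) simp
  have finK: "finite ?KK"
    by simp
  have finT: "\<forall>K\<in>?KK. finite (?T K)" and finS: "\<forall>A\<in>\<F>. finite (?S A)"
    using finJ by auto
  have "?L = (\<Sum>K\<in>?KK. \<Sum>D\<in>?T K. 1 / real (card (K \<inter> J) choose d))"
    by simp
  also have "\<dots> = (\<Sum>(K, D)\<in>Sigma ?KK ?T. 1 / real (card (K \<inter> J) choose d))"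
    by (rule sum.Sigma[OF finK finT])
  also have "\<dots> = (\<Sum>(A, D)\<in>Sigma \<F> ?S. 1 / real (card (A \<inter> J) + d choose d))"
  proof (rule sum.reindex_bij_witness[where
        j = "\<lambda>(K, D). (K - D, D)" and i = "\<lambda>(A, D). (A \<union> D, D)"], goal_cases)
    case (4 p)
    then obtain A D where p: "p = (A, D)" "A \<in> \<F>" "D \<subseteq> J - A" "card D = d"
      by auto
    have "finite D"
      using p finJ finite_subset[of D J] by auto
    moreover have "A \<union> D - D = A"
      using p by blast
    ultimately show ?case
      using p finA[of A] J card_Un_disjoint[of A D] by auto
  next
    case (5 p)
    then obtain K D where p: "p = (K, D)" "K \<subseteq> {1..n}" "D \<subseteq> K \<inter> J" "card D = d"
      by auto
    have "finite (K \<inter> J)" "finite D"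
      using p(3) finJ finite_subset[of D J] by auto
    then have "card ((K - D) \<inter> J) + d = card (K \<inter> J)"
      using p card_mono[of "K \<inter> J" D] card_Diff_subset[of D "K \<inter> J"]
      by (simp add: Diff_Int_distrib2 Int_absorb2)
    then show ?case
      using p by simp
  qed (use finJ in auto)
  also have "\<dots> = (\<Sum>A\<in>\<F>. \<Sum>D\<in>?S A. 1 / real (card (A \<inter> J) + d choose d))"
    by (rule sum.Sigma[OF finF finS, symmetric])
  also have "\<dots> = ?R"
  proof (rule sum.cong)
    fix A assume "A \<in> \<F>"
    have "card (J - A) = card J - card (A \<inter> J)"
      using finJ by (simp add: card_Diff_subset_Int Int_commute)
    then show "(\<Sum>D\<in>?S A. 1 / real (card (A \<inter> J) + d choose d))
      = real ((card J - card (A \<inter> J)) choose d) / real (card (A \<inter> J) + d choose d)"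
      using finJ by (simp add: n_subsets)
  qed simp
  finally show ?thesis .
qed

section \<open>Binomial estimates and convexity\<close>

text \<open>The right-hand side is the falling factorial, whose smallest factor is
  \<open>N + 1 - d\<close>.\<close>

lemma power_le_fact_mult_binomial: "(N + 1 - d) ^ d \<le> fact d * (N choose d)"
proof (induction d)
  case (Suc d)
  have "(N + 1 - Suc d) ^ Suc d \<le> (N - d) * (N + 1 - d) ^ d"
    by (simp add: power_mono mult_le_mono)
  also have "\<dots> \<le> (N - d) * (fact d * (N choose d))"
    using Suc.IH by (rule mult_le_mono2)
  also have "\<dots> = fact d * (Suc d * (N choose Suc d))"
    using binomial_absorb_comp[of N d] binomial_absorption[of d N]
    by (simp del: mult_Suc)
  finally show ?case
    by (simp only: fact_Suc of_nat_id ac_simps)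
qed simp

text \<open>Compare the smallest factor \<open>s - a + 1 - d\<close> of the numerator with the
  largest factor \<open>a + d\<close> of the denominator. Truncation at 0 covers blocks with
  \<open>a + d > s\<close>.\<close>

lemma binomial_ratio_ge:
  assumes "0 < d"
  shows "max 0 (real (s + 1) / real (a + d) - 1) ^ d \<le> real ((s - a) choose d) / real (a + d choose d)"
proof (cases "a + d \<le> s")
  case True
  define N where "N = s - a"
  have 1: "real (N + 1 - d) ^ d \<le> fact d * real (N choose d)"
    using power_le_fact_mult_binomial[of N d] by (metis of_nat_fact of_nat_le_iff of_nat_mult of_nat_power)
  have 2: "fact d * real (a + d choose d) \<le> real (a + d) ^ d"
    using binomial_fact_pow[of "a + d" d]
    by (metis mult.commute of_nat_fact of_nat_le_iff of_nat_mult of_nat_power)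
  have "real (s + 1) / real (a + d) - 1 = real (N + 1 - d) / real (a + d)"
    using True assms by (simp add: N_def field_simps of_nat_diff)
  then have "max 0 (real (s + 1) / real (a + d) - 1) ^ d = real (N + 1 - d) ^ d / real (a + d) ^ d"
    by (simp add: power_divide max_def)
  also have "\<dots> \<le> (fact d * real (N choose d)) / (fact d * real (a + d choose d))"
    by (intro frac_le 1 2) simp_all
  also have "\<dots> = real (N choose d) / real (a + d choose d)"
    by simp
  finally show ?thesis
    by (simp add: N_def)
next
  case False
  then have "real (s + 1) / real (a + d) \<le> 1"
    by (simp add: field_simps)
  then show ?thesis
    using assms by (simp add: max_def power_0_left)
qed

text \<open>Jensen's inequality for a convex decreasing function, without derivatives: each summand
  is bounded below by a non-increasing affine function of \<open>y i\<close>, so only the sum of the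
  \<open>y i\<close> matters.\<close>

lemma sum_power_ratio_ge:
  fixes y :: "nat \<Rightarrow> real"
  assumes y: "\<And>i. i < m \<Longrightarrow> 0 < y i" and "0 < z" "(\<Sum>i<m. y i) \<le> real m * z" "z < S"
  shows "real m * (S / z - 1) ^ d \<le> (\<Sum>i<m. max 0 (S / y i - 1) ^ d)"
proof -
  define p where "p = S / z - 1"
  have p: "0 < p"
    using assms by (simp add: p_def)
  define u where "u i = 2 / z - y i / z\<^sup>2" for i
  have u: "(\<Sum>i<m. u i) = 2 * m / z - (\<Sum>i<m. y i) / z\<^sup>2"
    by (simp add: u_def sum_subtractf sum_divide_distrib)
  \<comment> \<open>Bernoulli's inequality and then the tangent line of \<open>1 / y\<close> at \<open>z\<close>\<close>
  have "p ^ d * (1 + d * (S / p * u i - 1 / p - 1)) \<le> max 0 (S / y i - 1) ^ d"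
    if "i < m" for i
  proof -
    let ?q = "max 0 (S / y i - 1)"
    have "0 \<le> (y i - z)\<^sup>2 / (y i * z\<^sup>2)"
      using y[OF that] by simp
    also have "\<dots> = 1 / y i - u i"
      using y[OF that] \<open>0 < z\<close> by (simp add: u_def field_simps power2_eq_square)
    finally have "S * u i \<le> S * (1 / y i)"
      using assms by (intro mult_left_mono) auto
    then have "S * u i - 1 \<le> ?q"
      by simp
    then have "(S * u i - 1) / p \<le> ?q / p"
      using p by (intro divide_right_mono) auto
    then have "1 + real d * (S / p * u i - 1 / p - 1) \<le> 1 + real d * (?q / p - 1)"
      by (intro add_left_mono mult_left_mono) (auto simp: diff_divide_distrib)
    \<comment> \<open>Bernoulli needs \<open>?q / p - 1\<close> to be at least -1, which the
      truncation in \<open>?q\<close> ensures.\<close>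
    also have "\<dots> \<le> (1 + (?q / p - 1)) ^ d"
      using p by (intro Bernoulli_inequality) simp
    finally have "p ^ d * (1 + d * (S / p * u i - 1 / p - 1)) \<le> p ^ d * (?q / p) ^ d"
      using p by (intro mult_left_mono) auto
    also have "\<dots> = ?q ^ d"
      using p by (simp add: power_divide)
    finally show ?thesis .
  qed
  then have "(\<Sum>i<m. p ^ d * (1 + d * (S / p * u i - 1 / p - 1)))
      \<le> (\<Sum>i<m. max 0 (S / y i - 1) ^ d)"
    by (intro sum_mono) simp
  moreover have "(\<Sum>i<m. p ^ d * (1 + d * (S / p * u i - 1 / p - 1)))
      = p ^ d * (m + d * (S / p * (\<Sum>i<m. u i) - m / p - m))"
    by (simp add: sum.distrib sum_subtractf flip: sum_distrib_left sum_divide_distrib)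
  \<comment> \<open>The correction term vanishes when all \<open>y i\<close> equal \<open>z\<close>,
    because \<open>S / z = p + 1\<close>; a smaller sum only increases it.\<close>
  moreover have "real m \<le> m + d * (S / p * (\<Sum>i<m. u i) - m / p - m)"
  proof -
    have "(\<Sum>i<m. y i) / z\<^sup>2 \<le> m * z / z\<^sup>2"
      using assms by (intro divide_right_mono) auto
    also have "\<dots> = m / z"
      using \<open>0 < z\<close> by (simp add: power2_eq_square)
    finally have "S / p * (m / z) \<le> S / p * (\<Sum>i<m. u i)"
      using assms p unfolding u by (intro mult_left_mono) auto
    moreover have "S / p * (m / z) = m / p + m"
      using p \<open>0 < z\<close> by (simp add: p_def field_simps)
    ultimately show ?thesis
      by simp
  qed
  then have "p ^ d * m \<le> p ^ d * (m + d * (S / p * (\<Sum>i<m. u i) - m / p - m))"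
    using p by (intro mult_left_mono) auto
  ultimately show ?thesis
    by (simp add: p_def mult.commute)
qed

text \<open>Each step from \<open>k + d\<close> to \<open>k + d + 1\<close> multiplies by
  \<open>(n - k - d) / (k + d + 1)\<close>, which is at most \<open>(n - k) / k\<close>.\<close>

lemma binomial_add_le:
  assumes "0 < k" "k + d \<le> n"
  shows "real (n choose (k + d)) \<le> (real (n - k) / real k) ^ d * real (n choose k)"
  using assms(2)
proof (induction d)
  case (Suc d)
  have "Suc (k + d) * (n choose Suc (k + d)) = (n - (k + d)) * (n choose (k + d))"
    using binomial_absorb_comp[of n "k + d"] binomial_absorption[of "k + d" n] by simp
  then have "real (n choose Suc (k + d)) = real (n - (k + d)) / real (Suc (k + d)) * real (n choose (k + d))"
    by (metis nonzero_eq_divide_eq of_nat_Suc of_nat_mult of_nat_neq_0 mult.commute times_divide_eq_left)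
  also have "\<dots> \<le> real (n - k) / real k * real (n choose (k + d))"
    using assms(1) by (intro mult_right_mono frac_le) auto
  also have "\<dots> \<le> real (n - k) / real k * ((real (n - k) / real k) ^ d * real (n choose k))"
    using Suc by (intro mult_left_mono) auto
  finally show ?case
    by (simp add: ac_simps)
qed simp

section \<open>The bound for a given number of blocks\<close>

lemma card_IP_free_le:
  fixes n k d m :: nat
  assumes F: "\<F> \<subseteq> {A. A \<subseteq> {1..n} \<and> card A = k}" and free: "pattern_free (IP d) \<F>"
    and "0 < d" "0 < m" "4 * d\<^sup>2 * m \<le> k" "2 * k \<le> n"
  shows "real m * real (card \<F>) \<le> 3 * real (n choose k)"
proof -
  define s where "s = n div m"
  define J where "J i = {i * s + 1..i * s + s}" for i
  \<comment> \<open>\<open>z\<close> bounds the average of \<open>card (A \<inter> J i) + d\<close>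
    over the blocks, and \<open>e\<close> is the total shift, so that
    \<open>m * z = k + e\<close>.\<close>
  define z where "z = k / m + d"
  define p where "p = real (s + 1) / z - 1"
  define q where "q = real (n - k)"
  define e where "e = real m * real d"
  have ms: "m * s \<le> n" and "n < m * (s + 1)"
    using \<open>0 < m\<close> by (auto simp: s_def mult.commute dividend_less_times_div)
  then have ms': "real n \<le> real m * real (s + 1)"
    by (metis less_imp_le of_nat_le_iff of_nat_mult)
  have less: "x < y" if "i < j" "x \<in> J i" "y \<in> J j" for i j x y
  proof -
    have "i * s + s \<le> j * s"
      using that(1) mult_le_mono1[of "Suc i" j s] by simp
    then show ?thesis
      using that by (simp add: J_def)
  qed
  have Jn: "J i \<subseteq> {1..n}" if "i < m" for i
    using mult_le_mono1[of "Suc i" m s] that ms by (auto simp: J_def)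
  have cJ: "card (J i) = s" for i
    by (simp add: J_def)
  have kpos: "0 < k"
    using assms by (metis gr0I le_zero_eq mult_is_0 neq0_conv power_not_zero zero_neq_numeral)
  have de: "4 * (d * e) \<le> k"
    using assms(5) unfolding e_def power2_eq_square
    by (metis (no_types, opaque_lifting) mult.assoc mult.commute of_nat_le_iff of_nat_mult of_nat_numeral)
  have epos: "0 < e" and d1: "1 \<le> real d"
    using assms by (auto simp: e_def)
  have eled: "e \<le> d * e"
    using d1 epos by simp
  have kq: "k \<le> q" "0 < q"
    using assms(6) kpos by (auto simp: q_def)
  have mz: "m * z = k + e"
    using \<open>0 < m\<close> by (simp add: z_def e_def field_simps)
  have zpos: "0 < z"
    using assms by (simp add: z_def add_nonneg_pos)
  have nq: "real n = k + q"
    using assms(6) by (simp add: q_def)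
  \<comment> \<open>The \<open>+ 1\<close> in \<open>s + 1\<close> absorbs the rounding in
    \<open>n div m\<close>, since \<open>m * (s + 1)\<close> is at least
    \<open>n = k + q\<close>.\<close>
  have pge: "(q - e) / (k + e) \<le> p"
  proof -
    have "p = (m * real (s + 1) - m * z) / (m * z)"
      using \<open>0 < m\<close> zpos by (simp add: p_def field_simps)
    then show ?thesis
      unfolding mz using ms' nq epos by (simp add: divide_right_mono)
  qed
  have ltq: "e < q"
    using eled de kq by linarith
  have ppos: "0 < p"
    using pge ltq epos by (meson add_nonneg_pos diff_gt_0_iff_gt divide_pos_pos less_le_trans of_nat_0_le_iff)
  have zs: "z < real (s + 1)"
    using ppos zpos by (simp add: p_def)
  \<comment> \<open>After cross-multiplication there is a gain \<open>q * k\<close> against losses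
    of at most \<open>q * k / 4\<close> and \<open>q * k / 2\<close>. Both follow from
    \<open>4 * (d * e) \<le> k\<close>, which is the assumed bound on \<open>m\<close>. The
    \<open>d\<close>-th power then costs at most \<open>exp 1\<close>, hence the factor 3.\<close>
  have "q / k \<le> (1 + 1 / d) * p"
  proof -
    have 1: "q * (d * e) \<le> q * (k / 4)"
      using de kq by (intro mult_left_mono) auto
    have 2: "(d * e + e) * k \<le> (k / 2) * q"
    proof (rule mult_mono)
      show "d * e + e \<le> k / 2"
        using de eled by linarith
    qed (use kq in auto)
    have 3: "0 \<le> q * k"
      using kq by simp
    have "(d + 1) * (q - e) * k - q * (k + e) * d = q * k - q * (d * e) - (d * e + e) * k"
      by (simp add: algebra_simps)
    with 1 2 3 have 4: "q * (k + e) * d \<le> (d + 1) * (q - e) * k"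
      by (simp add: mult.commute)
    have pos: "0 < (k + e) * d" "0 < real k"
      using kpos d1 epos by auto
    have "q / k \<le> (d + 1) * (q - e) / ((k + e) * d)"
      using 4
      by (simp only: pos_le_divide_eq[OF pos(1)] times_divide_eq_left pos_divide_le_eq[OF pos(2)] mult.assoc)
    also have "\<dots> = (d + 1) / d * ((q - e) / (k + e))"
      by (simp only: times_divide_times_eq mult.commute)
    also have "(d + 1) / d = 1 + 1 / real d"
      using d1 by (simp add: field_simps)
    also have "(1 + 1 / d) * ((q - e) / (k + e)) \<le> (1 + 1 / d) * p"
      using pge by (intro mult_left_mono) auto
    finally show ?thesis .
  qed
  then have "(q / k) ^ d \<le> ((1 + 1 / d) * p) ^ d"
    using kq by (intro power_mono) auto
  also have "\<dots> = (1 + 1 / d) ^ d * p ^ d"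
    by (simp add: power_mult_distrib)
  also have "\<dots> \<le> 3 * p ^ d"
  proof (rule mult_right_mono)
    have "(1 + 1 / real d) ^ d \<le> exp (1 / d) ^ d"
      by (intro power_mono exp_ge_add_one_self) auto
    also have "\<dots> = exp 1"
      using \<open>0 < d\<close> by (simp flip: exp_of_nat_mult)
    finally show "(1 + 1 / real d) ^ d \<le> 3"
      using exp_le by linarith
  qed (use ppos in simp)
  finally have qp: "(q / k) ^ d \<le> 3 * p ^ d" .

  let ?w = "\<lambda>A i. real ((card (J i) - card (A \<inter> J i)) choose d) / real (card (A \<inter> J i) + d choose d)"
  have lower: "m * p ^ d \<le> (\<Sum>i<m. ?w A i)" if "A \<in> \<F>" for A
  proof -
    have A: "finite A" "card A = k"
      using that F finite_subset[of A "{1..n}"] by auto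
    have "(\<Sum>i<m. card (A \<inter> J i)) = card (\<Union>i<m. A \<inter> J i)"
      using A less by (subst card_UN_disjoint) (auto, metis less_irrefl nat_neq_iff)
    also have "\<dots> \<le> k"
      using A card_mono[of A "\<Union>i<m. A \<inter> J i"] by auto
    finally have "(\<Sum>i<m. real (card (A \<inter> J i) + d)) \<le> k + e"
      by (simp add: sum.distrib e_def flip: of_nat_sum)
    then have "m * p ^ d \<le> (\<Sum>i<m. max 0 (real (s + 1) / real (card (A \<inter> J i) + d) - 1) ^ d)"
      unfolding p_def using zpos zs \<open>0 < d\<close> mz by (intro sum_power_ratio_ge) auto
    also have "\<dots> \<le> (\<Sum>i<m. ?w A i)"
      unfolding cJ by (intro sum_mono binomial_ratio_ge \<open>0 < d\<close>)
    finally show ?thesis .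
  qed

  let ?v = "\<lambda>K i. real (card {D. D \<subseteq> K \<inter> J i \<and> card D = d \<and> K - D \<in> \<F>})
    / real (card (K \<inter> J i) choose d)"
  let ?KK = "{K. K \<subseteq> {1..n} \<and> card K = k + d}"
  have "card \<F> * (m * p ^ d) = (\<Sum>A\<in>\<F>. m * p ^ d)"
    by simp
  also have "\<dots> \<le> (\<Sum>A\<in>\<F>. \<Sum>i<m. ?w A i)"
    by (intro sum_mono lower)
  also have "\<dots> = (\<Sum>i<m. \<Sum>A\<in>\<F>. ?w A i)"
    by (rule sum.swap)
  also have "\<dots> = (\<Sum>i<m. \<Sum>K\<in>?KK. ?v K i)"
    using sum_weight_swap[OF F Jn] by (intro sum.cong[OF refl]) simp
  also have "\<dots> = (\<Sum>K\<in>?KK. \<Sum>i<m. ?v K i)"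
    by (rule sum.swap)
  also have "\<dots> \<le> (\<Sum>K\<in>?KK. 1)"
    using less by (intro sum_mono weight_le_one free) (auto intro: finite_subset)
  also have "\<dots> = real (n choose (k + d))"
    by (simp add: n_subsets)
  also have "\<dots> \<le> (q / k) ^ d * real (n choose k)"
  proof -
    \<comment> \<open>This gives \<open>d \<le> k\<close>, so \<open>2 * k \<le> n\<close> yields
      \<open>k + d \<le> n\<close>.\<close>
    have "real d * 1 \<le> d * e"
      using d1 epos \<open>0 < d\<close> \<open>0 < m\<close> mult_mono[of 1 "real m" 1 "real d"]
      by (intro mult_left_mono) (auto simp: e_def)
    then have "d \<le> k"
      using de by simp
    then show ?thesis
      unfolding q_def using kpos assms(6) by (intro binomial_add_le) auto
  qed
  also have "\<dots> \<le> 3 * p ^ d * real (n choose k)"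
    using qp by (intro mult_right_mono) auto
  finally have "p ^ d * (m * card \<F>) \<le> p ^ d * (3 * (n choose k))"
    by (simp add: ac_simps)
  then show ?thesis
    using ppos by (simp add: mult_le_cancel_left_pos)
qed

section \<open>Choice of the number of blocks\<close>

lemma delta_le:
  assumes "\<And>\<F>. \<F> \<subseteq> {A. A \<subseteq> {1..n} \<and> card A = k} \<Longrightarrow> pattern_free P \<F> \<Longrightarrow>
    real (card \<F>) \<le> c * real (n choose k)" and "k \<le> n"
  shows "delta n k P \<le> c"
proof -
  let ?S = "{card \<A> |\<A>. \<A> \<subseteq> {A. A \<subseteq> {1..n} \<and> card A = k} \<and> pattern_free P \<A>}"
  have "Max ?S \<in> ?S"
    using delta_Max_welldefined[of n k P] by (rule Max_in)
  then have "real (Max ?S) \<le> c * real (n choose k)"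
    using assms(1) by auto
  then show ?thesis
    unfolding delta_def using assms(2) by (simp add: pos_divide_le_eq)
qed

theorem theorem2:
  shows "\<exists>C::real. C > 0 \<and>
    (\<forall>d k n :: nat. 0 < k \<longrightarrow> 2 * k \<le> n \<longrightarrow>
      delta n k (IP d) \<le> C * (real d ^ 2 / real k))"
\<comment> \<open>24 is 3 from \<open>card_IP_free_le\<close>, times 4 from its condition on
  \<open>m\<close>, times 2 for rounding \<open>m\<close> down.\<close>
proof (intro exI[of _ 24] conjI allI impI)
  fix d k n :: nat
  assume k: "0 < k" and n: "2 * k \<le> n"
  show "delta n k (IP d) \<le> 24 * (real d ^ 2 / real k)"
  proof (rule delta_le)
    fix \<F> assume F: "\<F> \<subseteq> {A. A \<subseteq> {1..n} \<and> card A = k}" and free: "pattern_free (IP d) \<F>"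
    define m where "m = k div (4 * d\<^sup>2)"
    consider "d = 0" | "0 < d" "m = 0" | "0 < d" "0 < m"
      by blast
    then show "real (card \<F>) \<le> 24 * (real d ^ 2 / real k) * real (n choose k)"
    proof cases
      case 1
      have "pat A A = IP 0" for A
        by (simp add: pat_def IP_def)
      then have "\<F> = {}"
        using free 1 unfolding pattern_free_def by blast
      then show ?thesis
        by simp
    next
      case 2
      \<comment> \<open>Here the claimed bound exceeds 1, so the trivial bound on
        \<open>card \<F>\<close> suffices.\<close>
      then have "k < 4 * d\<^sup>2"
        by (simp add: m_def div_eq_0_iff)
      then have "real k < real (4 * d\<^sup>2)"
        by (simp only: of_nat_less_iff)
      then have "real k \<le> 24 * real d ^ 2"
        by simp
      then have "1 * real (n choose k) \<le> 24 * (real d ^ 2 / real k) * real (n choose k)"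
        using k by (intro mult_right_mono) (auto simp: field_simps)
      moreover have "card \<F> \<le> n choose k"
        using card_mono[OF _ F] by (simp add: n_subsets)
      ultimately show ?thesis
        by linarith
    next
      case 3
      have "4 * d\<^sup>2 * m \<le> k" "k < 4 * d\<^sup>2 * (m + 1)"
        using 3 by (auto simp: m_def dividend_less_times_div)
      \<comment> \<open>Since \<open>m\<close> is at least 1, \<open>m + 1\<close> is at most
        \<open>2 * m\<close>.\<close>
      moreover have "4 * d\<^sup>2 * (m + 1) \<le> 8 * d\<^sup>2 * m"
        using 3 by (simp add: algebra_simps)
      ultimately have "k \<le> 8 * d\<^sup>2 * m"
        by linarith
      then have "real k \<le> real (8 * d\<^sup>2 * m)"
        by (simp only: of_nat_le_iff)
      then have "real k \<le> 8 * real d ^ 2 * real m"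
        by simp
      then have "real k * real (card \<F>) \<le> 8 * real d ^ 2 * (real m * real (card \<F>))"
        by (simp flip: mult.assoc add: mult_right_mono)
      also have "\<dots> \<le> 8 * real d ^ 2 * (3 * real (n choose k))"
        using card_IP_free_le[OF F free] 3 \<open>4 * d\<^sup>2 * m \<le> k\<close> n by (intro mult_left_mono) auto
      finally show ?thesis
        using k by (simp add: field_simps)
    qed
  qed (use n in simp)
qed simp

end
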